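(* Let $P$ be a rectangular poset of width $w$ and height $h$, and let $Q$ be any finite poset. Then the maximum size of a semiantichain in $P\times Q$ equals the minimum size of a unichain covering of $P\times Q$, and this number is $w\,d_h(Q)$.
   Context: A weak order is a poset whose ground set is partitioned into levels $L_1,\dots,L_h$ such that $x<y$ iff the level index of $x$ is smaller than that of $y$. A finite poset $P$ is rectangular (of width $w$ and height $h$) if, on the same ground set, there are a poset $L$ that is the disjoint union of $w$ chains each with $h$ elements and a weak order $U$ with $h$ levels each of size $w$ such that $L\subseteq P\subseteq U$ as binary relations. The product $P\times Q$ is ordered componentwise. A unichain is a chain of the form $\{p\}\times C'$ ($C'$ a chain of $Q$) or $C\times\{q\}$ ($C$ a chain of $P$); a unichain covering is a family of unichains whose union is $P\times Q$; a semiantichain is a set $S\subseteq P\times Q$ no two distinct elements of which lie in a common unichain. $d_k(Q)$ is the maximum size of a union of $k$ antichains of $Q$. *)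

theory Defs
  imports Main "HOL-Library.Disjoint_Sets"
begin

text \<open>A poset is a carrier set \<^term>\<open>A\<close> together with a reflexive order relation \<^term>\<open>r\<close> satisfying
  \<^term>\<open>partial_order_on A r\<close>. Since such an \<^term>\<open>r\<close> is reflexive on \<^term>\<open>A\<close> and contained in
  \<^term>\<open>A \<times> A\<close>, its chains (subsets of \<^term>\<open>A\<close>) are exactly the elements of
  \<^term>\<open>Chains r\<close>.\<close>

definition weak_order_levels :: "'a set \<Rightarrow> 'a rel \<Rightarrow> nat \<Rightarrow> (nat \<Rightarrow> 'a set) \<Rightarrow> bool" where
  "weak_order_levels A r h Lv \<longleftrightarrow>
     partial_order_on A r \<and>
     disjoint_family_on Lv {1..h} \<and> (\<Union>i\<in>{1..h}. Lv i) = A \<and>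
     (\<forall>i\<in>{1..h}. \<forall>j\<in>{1..h}. \<forall>x\<in>Lv i. \<forall>y\<in>Lv j. ((x, y) \<in> r \<and> x \<noteq> y) \<longleftrightarrow> i < j)"

definition disjoint_union_of_chains :: "'a set \<Rightarrow> 'a rel \<Rightarrow> nat \<Rightarrow> (nat \<Rightarrow> 'a set) \<Rightarrow> bool" where
  "disjoint_union_of_chains A r w C \<longleftrightarrow>
     partial_order_on A r \<and>
     disjoint_family_on C {1..w} \<and> (\<Union>i\<in>{1..w}. C i) = A \<and>
     (\<forall>i\<in>{1..w}. C i \<in> Chains r) \<and>
     (\<forall>i\<in>{1..w}. \<forall>j\<in>{1..w}. \<forall>x\<in>C i. \<forall>y\<in>C j. i \<noteq> j \<longrightarrow> (x, y) \<notin> r)"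

definition rectangular :: "'a set \<Rightarrow> 'a rel \<Rightarrow> nat \<Rightarrow> nat \<Rightarrow> bool" where
  "rectangular A r w h \<longleftrightarrow>
     finite A \<and> partial_order_on A r \<and>
     (\<exists>L U.
        (\<exists>C. disjoint_union_of_chains A L w C \<and> (\<forall>i\<in>{1..w}. card (C i) = h)) \<and>
        (\<exists>Lv. weak_order_levels A U h Lv \<and> (\<forall>i\<in>{1..h}. card (Lv i) = w)) \<and>
        L \<subseteq> r \<and> r \<subseteq> U)"

definition prod_order :: "'a rel \<Rightarrow> 'b rel \<Rightarrow> ('a \<times> 'b) rel" where
  "prod_order r s = {((p, q), (p', q')). (p, p') \<in> r \<and> (q, q') \<in> s}"

definition unichain :: "'a set \<Rightarrow> 'a rel \<Rightarrow> 'b set \<Rightarrow> 'b rel \<Rightarrow> ('a \<times> 'b) set \<Rightarrow> bool" where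
  "unichain A r B s X \<longleftrightarrow>
     X \<in> Chains (prod_order r s) \<and>
     ((\<exists>p\<in>A. \<exists>C'\<in>Chains s. X = {p} \<times> C') \<or> (\<exists>C\<in>Chains r. \<exists>q\<in>B. X = C \<times> {q}))"

definition unichain_covering ::
  "'a set \<Rightarrow> 'a rel \<Rightarrow> 'b set \<Rightarrow> 'b rel \<Rightarrow> ('a \<times> 'b) set set \<Rightarrow> bool" where
  "unichain_covering A r B s \<F> \<longleftrightarrow> (\<forall>X\<in>\<F>. unichain A r B s X) \<and> \<Union>\<F> = A \<times> B"

definition semiantichain :: "'a set \<Rightarrow> 'a rel \<Rightarrow> 'b set \<Rightarrow> 'b rel \<Rightarrow> ('a \<times> 'b) set \<Rightarrow> bool" where
  "semiantichain A r B s S \<longleftrightarrow>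
     S \<subseteq> A \<times> B \<and>
     (\<forall>x\<in>S. \<forall>y\<in>S. x \<noteq> y \<longrightarrow> \<not> (\<exists>X. unichain A r B s X \<and> x \<in> X \<and> y \<in> X))"

definition antichain :: "'a set \<Rightarrow> 'a rel \<Rightarrow> 'a set \<Rightarrow> bool" where
  "antichain A r X \<longleftrightarrow> X \<subseteq> A \<and> (\<forall>x\<in>X. \<forall>y\<in>X. x \<noteq> y \<longrightarrow> (x, y) \<notin> r)"

definition max_antichain_union :: "nat \<Rightarrow> 'a set \<Rightarrow> 'a rel \<Rightarrow> nat" where
  "max_antichain_union k A r =
     Max {card (\<Union>i<k. F i) | F. \<forall>i<k. antichain A r (F i)}"

definition max_semiantichain_size :: "'a set \<Rightarrow> 'a rel \<Rightarrow> 'b set \<Rightarrow> 'b rel \<Rightarrow> nat" where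
  "max_semiantichain_size A r B s = Max {card S | S. semiantichain A r B s S}"

definition min_unichain_covering_size :: "'a set \<Rightarrow> 'a rel \<Rightarrow> 'b set \<Rightarrow> 'b rel \<Rightarrow> nat" where
  "min_unichain_covering_size A r B s = Min {card \<F> | \<F>. unichain_covering A r B s \<F>}"

text \<open>For finite posets the sets under \<^term>\<open>Max\<close> and \<^term>\<open>Min\<close> are finite and nonempty, and every
  covering is a finite family, so these extrema and cardinalities are the genuine ones.\<close>

lemma antichain_union_sizes:
  assumes "finite A"
  shows "finite {card (\<Union>i<k. F i) | F. \<forall>i<k. antichain A r (F i)}"
    and "{card (\<Union>i<(k::nat). F i) | F. \<forall>i<k. antichain A r (F i)} \<noteq> {}"
proof -
  have "card (\<Union>i<k. F i) \<le> card A" if "\<forall>i<k. antichain A r (F i)" for F :: "nat \<Rightarrow> 'a set"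
  proof (rule card_mono[OF assms])
    show "(\<Union>i<k. F i) \<subseteq> A" using that by (fastforce simp: antichain_def)
  qed
  then have "{card (\<Union>i<k. F i) | F. \<forall>i<k. antichain A r (F i)} \<subseteq> {..card A}"
    by auto
  then show "finite {card (\<Union>i<k. F i) | F. \<forall>i<k. antichain A r (F i)}"
    by (rule finite_subset) simp
  have "card (\<Union>i<k. (\<lambda>_. {}) i) \<in> {card (\<Union>i<k. F i) | F. \<forall>i<k. antichain A r (F i)}"
    by (rule CollectI, rule exI[of _ "\<lambda>_. {}"]) (simp add: antichain_def)
  then show "{card (\<Union>i<k. F i) | F. \<forall>i<k. antichain A r (F i)} \<noteq> {}"
    by (metis empty_iff)
qed

lemma semiantichain_sizes:
  assumes "finite A" "finite B"
  shows "finite {card S | S. semiantichain A r B s S}"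
    and "{card S | S. semiantichain A r B s S} \<noteq> {}"
proof -
  have "{card S | S. semiantichain A r B s S} \<subseteq> card ` Pow (A \<times> B)"
    unfolding semiantichain_def by blast
  then show "finite {card S | S. semiantichain A r B s S}"
    by (rule finite_subset) (use assms in simp)
  have "semiantichain A r B s {}" by (simp add: semiantichain_def)
  then show "{card S | S. semiantichain A r B s S} \<noteq> {}" by auto
qed

lemma unichain_covering_sizes:
  assumes "finite A" "finite B" "partial_order_on A r" "partial_order_on B s"
  shows "unichain_covering A r B s \<F> \<Longrightarrow> finite \<F>"
    and "finite {card \<F> | \<F>. unichain_covering A r B s \<F>}"
    and "{card \<F> | \<F>. unichain_covering A r B s \<F>} \<noteq> {}"
proof -
  have fin: "finite (Pow (A \<times> B))" using assms by simp
  have sub: "\<F> \<subseteq> Pow (A \<times> B)" if "unichain_covering A r B s \<F>" for \<F>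
    using that unfolding unichain_covering_def by blast
  show "unichain_covering A r B s \<F> \<Longrightarrow> finite \<F>" using finite_subset[OF sub fin] .
  have "{card \<F> | \<F>. unichain_covering A r B s \<F>} \<subseteq> card ` Pow (Pow (A \<times> B))"
  proof
    fix n assume "n \<in> {card \<F> | \<F>. unichain_covering A r B s \<F>}"
    then obtain \<G> where "n = card \<G>" "unichain_covering A r B s \<G>" by auto
    then show "n \<in> card ` Pow (Pow (A \<times> B))" using sub[of \<G>] by (intro image_eqI PowI)
  qed
  then show "finite {card \<F> | \<F>. unichain_covering A r B s \<F>}"
    by (rule finite_subset) (use fin in simp)
  have refl: "\<And>p. p \<in> A \<Longrightarrow> (p, p) \<in> r" "\<And>q. q \<in> B \<Longrightarrow> (q, q) \<in> s"
    using partial_order_onD(1)[OF assms(3)] partial_order_onD(1)[OF assms(4)]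
    by (simp_all add: refl_on_def)
  have uni: "unichain A r B s {x}" if "x \<in> A \<times> B" for x
  proof -
    obtain p q where x: "x = (p, q)" and p: "p \<in> A" and q: "q \<in> B" using \<open>x \<in> A \<times> B\<close> by (rule SigmaE)
    have 1: "{q} \<in> Chains s" and 2: "{x} \<in> Chains (prod_order r s)" and 3: "{x} = {p} \<times> {q}"
      using refl(1)[OF p] refl(2)[OF q] by (simp_all add: x Chains_def prod_order_def)
    show ?thesis
      unfolding unichain_def by (intro conjI disjI1 2 bexI[of _ p] bexI[of _ "{q}"] 3 1 p)
  qed
  have "unichain_covering A r B s ((\<lambda>x. {x}) ` (A \<times> B))"
    unfolding unichain_covering_def using uni by (intro conjI ballI) (erule imageE, simp, simp)
  then show "{card \<F> | \<F>. unichain_covering A r B s \<F>} \<noteq> {}" by auto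
qed

end

theory Submission
  imports Defs
begin

text \<open>
  If \<^term>\<open>F\<close> is a disjoint family of \<^term>\<open>h\<close> antichains of \<^term>\<open>Q\<close> of maximum total size, pairing
  the levels of the weak order above \<^term>\<open>P\<close> with the members of \<^term>\<open>F\<close> gives a semiantichain of
  the required size. Conversely, Greene--Kleitman duality covers \<^term>\<open>Q\<close> by a set \<^term>\<open>S\<close> of points
  and a set \<^term>\<open>D\<close> of chains with \<^term>\<open>card S + h * card D \<le> max_antichain_union h Q leQ\<close>. The
  products of the \<^term>\<open>w\<close> chains below \<^term>\<open>P\<close> with the points of \<^term>\<open>S\<close>, together with the
  products of the \<^term>\<open>w * h\<close> points of \<^term>\<open>P\<close> with the chains in \<^term>\<open>D\<close>, form a covering of
  matching size.

  The duality is an instance of integral linear programming duality for the assignment problem: an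
  optimal integral dual solution has a perfect matching of tight edges by Hall's theorem, since a
  violation of Hall's condition would allow an improvement.
\<close>

section \<open>Hall's theorem and assignment duality\<close>

text \<open>Induction on \<open>card I\<close>. If a proper nonempty \<open>J\<close> is tight, it
  is matched first and the rest avoids the neighbours of \<open>J\<close>. If none is, every proper
  nonempty subset has a neighbour to spare, so one element can be matched arbitrarily.\<close>

theorem hall_marriage:
  fixes A :: "'i \<Rightarrow> 'b set"
  assumes "finite I" "\<And>i. i \<in> I \<Longrightarrow> finite (A i)"
    and "\<And>J. J \<subseteq> I \<Longrightarrow> card J \<le> card (\<Union>(A ` J))"
  shows "\<exists>f. inj_on f I \<and> (\<forall>i\<in>I. f i \<in> A i)"
  using assms
proof (induction "card I" arbitrary: I A rule: less_induct)
  case less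
  note fin = less.prems(1) and finA = less.prems(2) and hall = less.prems(3)
  show ?case
  proof (cases "\<exists>J. J \<subseteq> I \<and> J \<noteq> {} \<and> J \<noteq> I \<and> card (\<Union>(A ` J)) = card J")
    case True
    then obtain J where J: "J \<subseteq> I" "J \<noteq> {}" "J \<noteq> I" "card (\<Union>(A ` J)) = card J" by blast
    have finJ: "finite J" using J(1) fin by (rule finite_subset)
    have "card J < card I" using J fin by (intro psubset_card_mono) auto
    moreover have "finite (A i)" if "i \<in> J" for i using finA J(1) that by blast
    moreover have "card K \<le> card (\<Union>(A ` K))" if "K \<subseteq> J" for K
      using hall J(1) that by (meson subset_trans)
    ultimately have "\<exists>f. inj_on f J \<and> (\<forall>i\<in>J. f i \<in> A i)"
      using less.hyps[of J A, OF _ finJ] by blast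
    then obtain f where f: "inj_on f J" "\<forall>i\<in>J. f i \<in> A i" by blast
    define B where "B i = A i - \<Union>(A ` J)" for i
    have "card (I - J) < card I" using J fin by (intro psubset_card_mono) auto
    moreover have "card K \<le> card (\<Union>(B ` K))" if K: "K \<subseteq> I - J" for K
    proof -
      have finK: "finite K" using K fin finite_subset by blast
      have finB: "finite (\<Union>(B ` K))" using K finA finK by (auto simp: B_def)
      have finAJ: "finite (\<Union>(A ` J))" using J(1) finA finJ by auto
      have "card K + card J = card (K \<union> J)"
        using finK finJ K by (subst card_Un_disjoint) auto
      also have "\<dots> \<le> card (\<Union>(A ` (K \<union> J)))" using K J(1) by (intro hall) auto
      also have "\<Union>(A ` (K \<union> J)) = \<Union>(B ` K) \<union> \<Union>(A ` J)" by (auto simp: B_def)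
      also have "card \<dots> \<le> card (\<Union>(B ` K)) + card (\<Union>(A ` J))"
        by (rule card_Un_le)
      finally show ?thesis using J(4) by simp
    qed
    moreover have "finite (B i)" if "i \<in> I - J" for i using finA that by (simp add: B_def)
    ultimately have "\<exists>g. inj_on g (I - J) \<and> (\<forall>i\<in>I - J. g i \<in> B i)"
      using less.hyps[of "I - J" B, OF _ finite_Diff[OF fin]] by blast
    then obtain g where g: "inj_on g (I - J)" "\<forall>i\<in>I - J. g i \<in> B i" by blast
    define h where "h i = (if i \<in> J then f i else g i)" for i
    have "inj_on h (J \<union> (I - J))"
    proof (subst inj_on_Un, intro conjI)
      show "inj_on h J" using f(1) by (auto simp: h_def inj_on_def)
      show "inj_on h (I - J)" using g(1) by (auto simp: h_def inj_on_def)
      show "h ` (J - (I - J)) \<inter> h ` (I - J - J) = {}"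
        using f(2) g(2) by (fastforce simp: h_def B_def)
    qed
    moreover have "J \<union> (I - J) = I" using J(1) by auto
    moreover have "\<forall>i\<in>I. h i \<in> A i" using f(2) g(2) by (auto simp: h_def B_def)
    ultimately show ?thesis by auto
  next
    case False
    show ?thesis
    proof (cases "I = {}")
      case True
      then show ?thesis by simp
    next
      case nonempty: False
      then obtain a where a: "a \<in> I" by blast
      have "A a \<noteq> {}" using hall[of "{a}"] a by auto
      then obtain y where y: "y \<in> A a" by blast
      define B where "B i = A i - {y}" for i
      have "card (I - {a}) < card I" using a fin by (intro psubset_card_mono) auto
      moreover have "card K \<le> card (\<Union>(B ` K))" if K: "K \<subseteq> I - {a}" for K
      proof (cases "K = {}")
        case True
        then show ?thesis by simp
      next
        case ne: False
        have KI: "K \<subseteq> I" "K \<noteq> I" using K a by auto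
        then have "card (\<Union>(A ` K)) \<noteq> card K" using False ne by blast
        then have "card K < card (\<Union>(A ` K))" using hall[OF KI(1)] by simp
        moreover have "\<Union>(B ` K) = \<Union>(A ` K) - {y}" by (auto simp: B_def)
        moreover have "card (\<Union>(A ` K)) \<le> card (\<Union>(A ` K) - {y}) + 1"
          using diff_card_le_card_Diff[of "{y}" "\<Union>(A ` K)"] by simp
        ultimately show ?thesis by simp
      qed
      moreover have "finite (B i)" if "i \<in> I - {a}" for i using finA that by (simp add: B_def)
      ultimately have "\<exists>g. inj_on g (I - {a}) \<and> (\<forall>i\<in>I - {a}. g i \<in> B i)"
        using less.hyps[of "I - {a}" B, OF _ finite_Diff[OF fin]] by blast
      then obtain g where g: "inj_on g (I - {a})" "\<forall>i\<in>I - {a}. g i \<in> B i" by blast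
      have "inj_on (g(a := y)) I" using g by (fastforce simp: inj_on_def B_def)
      moreover have "\<forall>i\<in>I. (g(a := y)) i \<in> A i" using g(2) y by (auto simp: B_def)
      ultimately show ?thesis by blast
    qed
  qed
qed

text \<open>\<open>E\<close> marks the admissible edges, in place of infinite costs. Nonnegative
  costs make the zero potentials feasible and the cost of \<open>m\<close> bounds all dual values,
  so an optimal integral dual exists; Hall's theorem applies to its tight edges.\<close>

theorem egervary:
  fixes c :: "'x \<Rightarrow> 'y \<Rightarrow> int" and E :: "'x \<Rightarrow> 'y \<Rightarrow> bool"
  assumes fin: "finite X" "finite Y"
    and nonneg: "\<And>x y. 0 \<le> c x y"
    and m: "bij_betw m X Y" "\<And>x. x \<in> X \<Longrightarrow> E x (m x)"
  obtains u v f where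
    "\<And>x y. x \<in> X \<Longrightarrow> y \<in> Y \<Longrightarrow> E x y \<Longrightarrow> u x + v y \<le> c x y"
    "bij_betw f X Y" "\<And>x. x \<in> X \<Longrightarrow> E x (f x) \<and> u x + v (f x) = c x (f x)"
proof -
  define feas where "feas = (\<lambda>(u, v). \<forall>x\<in>X. \<forall>y\<in>Y. E x y \<longrightarrow> u x + v y \<le> c x y)"
  define val :: "('x \<Rightarrow> int) \<times> ('y \<Rightarrow> int) \<Rightarrow> int" where "val = (\<lambda>(u, v). sum u X + sum v Y)"
  define M where "M = (\<Sum>x\<in>X. c x (m x))"
  have bound: "val p \<le> M" if "feas p" for p
  proof -
    obtain u v where p: "p = (u, v)" by (cases p)
    have "val p = (\<Sum>x\<in>X. u x + v (m x))"
      using sum.reindex_bij_betw[OF m(1), of v] by (simp add: p val_def sum.distrib)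
    also have "\<dots> \<le> M" unfolding M_def
      using that m bij_betwE[OF m(1)] by (intro sum_mono) (auto simp: p feas_def)
    finally show ?thesis .
  qed
  have "feas (\<lambda>_. 0, \<lambda>_. 0)" using nonneg by (simp add: feas_def)
  \<comment> \<open>Dual values are integers at most \<open>M\<close>, so minimising
    \<open>nat (M - val p)\<close> maximises \<open>val p\<close>.\<close>
  then obtain p where p: "feas p" and opt: "\<And>q. feas q \<Longrightarrow> nat (M - val p) \<le> nat (M - val q)"
    using ex_has_least_nat[of feas _ "\<lambda>p. nat (M - val p)"] by blast
  obtain u v where uv: "p = (u, v)" by (cases p)
  define T where "T x = {y\<in>Y. E x y \<and> u x + v y = c x y}" for x
  have "card J \<le> card (\<Union>(T ` J))" if J: "J \<subseteq> X" for J
  proof (rule ccontr)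
    assume viol: "\<not> card J \<le> card (\<Union>(T ` J))"
    \<comment> \<open>By integrality a non-tight edge has slack at least 1, and tight edges from
      \<open>J\<close> end in \<open>N\<close>. So raising \<open>u\<close> on \<open>J\<close> and
      lowering \<open>v\<close> on \<open>N\<close> by 1 stays feasible and gains
      \<open>card J - card N\<close>.\<close>
    define u' where "u' x = u x + (if x \<in> J then 1 else 0)" for x
    define N where "N = \<Union>(T ` J)"
    define v' where "v' y = v y - (if y \<in> N then 1 else 0)" for y
    have "feas (u', v')" unfolding feas_def
    proof (clarify)
      fix x y assume xy: "x \<in> X" "y \<in> Y" "E x y"
      then have "u x + v y \<le> c x y" using p by (auto simp: uv feas_def)
      moreover have "u x + v y \<noteq> c x y \<or> y \<in> N" if "x \<in> J"
        using that xy by (auto simp: N_def T_def)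
      ultimately show "u' x + v' y \<le> c x y" by (auto simp: u'_def v'_def)
    qed
    moreover have "val (u', v') = val p + int (card J) - int (card N)"
    proof -
      have "N \<subseteq> Y" by (auto simp: N_def T_def)
      then have "sum v' Y = sum v Y - int (card N)"
        using fin by (simp add: v'_def sum_subtractf sum.If_cases Int_absorb1)
      moreover have "sum u' X = sum u X + int (card J)"
        using fin J by (simp add: u'_def sum.distrib sum.If_cases Int_absorb1)
      ultimately show ?thesis by (simp add: val_def uv)
    qed
    ultimately show False using opt[of "(u', v')"] bound[of "(u', v')"] viol by (simp add: N_def)
  qed
  then obtain f where f: "inj_on f X" "\<forall>x\<in>X. f x \<in> T x"
    using hall_marriage[of X T] fin by (auto simp: T_def)
  have "f ` X \<subseteq> Y" using f(2) by (auto simp: T_def)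
  then have "bij_betw f X Y"
    using f(1) fin bij_betw_same_card[OF m(1)] by (simp add: bij_betw_def card_image card_subset_eq)
  then show ?thesis using that[of u v f] p f(2) by (auto simp: uv feas_def T_def)
qed

section \<open>Greene-Kleitman duality\<close>

lemma card_le_max_antichain_union:
  assumes "finite A" "\<And>i. i < k \<Longrightarrow> antichain A r (F i)"
  shows "card (\<Union>i<k. F i) \<le> max_antichain_union k A r"
  unfolding max_antichain_union_def
  by (rule Max_ge[OF antichain_union_sizes(1)[OF assms(1)]]) (use assms(2) in blast)

text \<open>Removing from each member of an optimal family the earlier members leaves antichains
  with the same union.\<close>

lemma max_antichain_union_attained:
  assumes "finite A"
  obtains F where "\<And>i. i < k \<Longrightarrow> antichain A r (F i)" "disjoint_family F"
    "card (\<Union>i<k. F i) = max_antichain_union k A r"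
proof -
  obtain F where F: "\<forall>i<k. antichain A r (F i)"
    "card (\<Union>i<k. F i) = max_antichain_union k A r"
    using Max_in[OF antichain_union_sizes[OF assms, of k r]]
    unfolding max_antichain_union_def by auto
  show ?thesis
  proof (rule that[of "disjointed F"])
    show "antichain A r (disjointed F i)" if "i < k" for i
      using F(1) that disjointed_subset[of F i] unfolding antichain_def by blast
    show "card (\<Union>i<k. disjointed F i) = max_antichain_union k A r"
      using F(2) finite_UN_disjointed_eq[of F k] by (simp add: lessThan_atLeast0)
  qed (rule disjoint_family_disjointed)
qed

text \<open>The bound passes through \<open>cost\<close>, the value of an optimal assignment: its
  dual potentials yield \<open>k\<close> antichains whose union has size at least
  \<open>cost\<close>, and its matching \<open>f\<close> yields a cover of weight at most
  \<open>cost\<close>.\<close>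

theorem greene_kleitman_cover:
  fixes Q :: "'b set" and s :: "'b rel"
  assumes fin: "finite Q" and po: "partial_order_on Q s"
  obtains S D where "S \<subseteq> Q" "finite D" "\<And>C. C \<in> D \<Longrightarrow> C \<in> Chains s" "Q = S \<union> \<Union>D"
    "card S + k * card D \<le> max_antichain_union k Q s"
proof (cases "Q = {}")
  case True
  then show ?thesis using that[of "{}" "{}"] by simp
next
  case ne: False
  note refl = refl_onD[OF partial_order_onD(1)[OF po]]
    and trans = partial_order_onD(2)[OF po]
    and sub = partial_order_onD(4)[OF po]
  \<comment> \<open>In an assignment on two copies of \<open>Q <+> Q\<close>, the edge from \<open>Inl x\<close> to \<open>Inl y\<close> makes \<open>y\<close> the
    successor of \<open>x\<close> in a chain, or makes \<open>x\<close> a point of \<open>S\<close> (cost 1) if \<open>x = y\<close>. The points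
    \<open>Inr i\<close> are dummies: an edge from a dummy starts a chain (cost \<open>k\<close>), an edge to one ends it.\<close>
  define c :: "'b + 'b \<Rightarrow> 'b + 'b \<Rightarrow> int" where
    "c z t = (case t of Inl y \<Rightarrow> (case z of Inl x \<Rightarrow> if x = y then 1 else 0 | Inr _ \<Rightarrow> int k) | Inr _ \<Rightarrow> 0)"
    for z t
  define E :: "'b + 'b \<Rightarrow> 'b + 'b \<Rightarrow> bool" where
    "E z t = (case (z, t) of (Inl x, Inl y) \<Rightarrow> (x, y) \<in> s | _ \<Rightarrow> True)" for z t
  have finQQ: "finite (Q <+> Q)" using fin by simp
  have c_nonneg: "0 \<le> c z t" for z t by (auto simp: c_def split: sum.splits)
  \<comment> \<open>The identity, which covers \<open>Q\<close> by single points, serves as the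
    initial matching.\<close>
  have E_refl: "E z (id z)" if "z \<in> Q <+> Q" for z using that refl by (auto simp: E_def)
  obtain u v f where
    feas: "\<And>x y. x \<in> Q <+> Q \<Longrightarrow> y \<in> Q <+> Q \<Longrightarrow> E x y \<Longrightarrow> u x + v y \<le> c x y"
    and f: "bij_betw f (Q <+> Q) (Q <+> Q)"
    and tight: "\<And>x. x \<in> Q <+> Q \<Longrightarrow> E x (f x) \<and> u x + v (f x) = c x (f x)"
    using egervary[where m = id and c = c and E = E, OF finQQ finQQ c_nonneg bij_betw_id E_refl] by blast
  define cost where "cost = (\<Sum>z\<in>Q <+> Q. c z (f z))"

  have dual: "cost \<le> int (max_antichain_union k Q s)"
  proof -
    \<comment> \<open>Both maxima are attained at dummies, so feasibility of the edges at those
      dummies bounds the potentials of all elements, while every other dummy contributes at most as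
      much to the dual value.\<close>
    define \<sigma> where "\<sigma> = Max ((u \<circ> Inr) ` Q)"
    define \<tau> where "\<tau> = Max ((v \<circ> Inr) ` Q)"
    have \<sigma>: "\<And>i. i \<in> Q \<Longrightarrow> u (Inr i) \<le> \<sigma>" and \<tau>: "\<And>i. i \<in> Q \<Longrightarrow> v (Inr i) \<le> \<tau>"
      using fin by (auto simp: \<sigma>_def \<tau>_def)
    obtain i j where i: "i \<in> Q" "\<sigma> = u (Inr i)" and j: "j \<in> Q" "\<tau> = v (Inr j)"
    proof -
      have "\<sigma> \<in> (u \<circ> Inr) ` Q" "\<tau> \<in> (v \<circ> Inr) ` Q"
        unfolding \<sigma>_def \<tau>_def using fin ne by (intro Max_in; simp)+
      then show ?thesis using that by auto
    qed
    \<comment> \<open>Potentials normalised so that the dummies may be taken to have potential 0.\<close>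
    define a where "a x = - u (Inl x) - \<tau>" for x
    define b where "b x = v (Inl x) + \<sigma>" for x
    have st: "\<sigma> + \<tau> \<le> 0"
      using feas[of "Inr i" "Inr j"] i j by (simp add: InrI E_def c_def)
    have a: "0 \<le> a x" if "x \<in> Q" for x
      using feas[of "Inl x" "Inr j"] j that by (simp add: InrI InlI E_def c_def a_def)
    have b: "b x \<le> int k" if "x \<in> Q" for x
      using feas[of "Inr i" "Inl x"] i that by (simp add: InrI InlI E_def c_def b_def)
    have ab: "b y \<le> a x + (if x = y then 1 else 0)" if "(x, y) \<in> s" for x y
    proof -
      have "x \<in> Q" "y \<in> Q" using that sub by auto
      then have "u (Inl x) + v (Inl y) \<le> (if x = y then 1 else 0)"
        using feas[of "Inl x" "Inl y"] that by (simp add: InlI E_def c_def)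
      then show ?thesis using st by (simp add: a_def b_def)
    qed
    \<comment> \<open>By \<open>ab\<close> with \<open>x = y\<close> the gap
      \<open>b x - a x\<close> is at most 1; \<open>F i\<close> collects the elements of gap 1 with
      \<open>a x = i\<close>. As \<open>0 \<le> a x\<close> and \<open>b x \<le> k\<close>, only
      \<open>0 \<le> i < k\<close> occurs. For distinct comparable elements of \<open>F i\<close>,
      \<open>ab\<close> would give \<open>i + 1 \<le> i\<close>.\<close>
    define F where "F i = {x\<in>Q. b x = a x + 1 \<and> b x = int i + 1}" for i
    have anti: "antichain Q s (F i)" for i
      unfolding antichain_def
    proof (intro conjI ballI impI notI)
      fix x y assume "x \<in> F i" "y \<in> F i" "x \<noteq> y" "(x, y) \<in> s"
      then show False using ab[of x y] by (simp add: F_def)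
    qed (auto simp: F_def)
    have "{x\<in>Q. b x = a x + 1} \<subseteq> (\<Union>i<k. F i)"
    proof
      fix x assume "x \<in> {x\<in>Q. b x = a x + 1}"
      then show "x \<in> (\<Union>i<k. F i)" using a[of x] b[of x]
        by (intro UN_I[of "nat (a x)"]) (auto simp: F_def)
    qed
    moreover have "finite (\<Union>i<k. F i)" using fin by (auto simp: F_def)
    ultimately have "card {x\<in>Q. b x = a x + 1} \<le> card (\<Union>i<k. F i)" by (intro card_mono)
    also have "\<dots> \<le> max_antichain_union k Q s"
      using fin anti by (rule card_le_max_antichain_union)
    finally have le: "card {x\<in>Q. b x = a x + 1} \<le> max_antichain_union k Q s" .
    have "cost = (\<Sum>z\<in>Q <+> Q. u z) + (\<Sum>z\<in>Q <+> Q. v z)"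
    proof -
      have "cost = (\<Sum>z\<in>Q <+> Q. u z + v (f z))"
        unfolding cost_def using tight by (intro sum.cong) auto
      then show ?thesis using sum.reindex_bij_betw[OF f, of v] by (simp add: sum.distrib)
    qed
    also have "\<dots> = (\<Sum>x\<in>Q. u (Inl x) + u (Inr x) + v (Inl x) + v (Inr x))"
      unfolding sum.Plus[OF fin fin] by (simp add: sum.distrib)
    also have "\<dots> \<le> (\<Sum>x\<in>Q. b x - a x)"
    proof (rule sum_mono)
      fix x assume "x \<in> Q"
      then show "u (Inl x) + u (Inr x) + v (Inl x) + v (Inr x) \<le> b x - a x"
        using \<sigma>[of x] \<tau>[of x] by (simp add: a_def b_def)
    qed
    also have "\<dots> \<le> (\<Sum>x\<in>Q. if b x = a x + 1 then 1 else 0)"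
    proof (rule sum_mono)
      fix x assume "x \<in> Q"
      then show "b x - a x \<le> (if b x = a x + 1 then 1 else 0)"
        using ab[OF refl, of x] by simp
    qed
    also have "\<dots> = int (card {x\<in>Q. b x = a x + 1})"
      using fin by (simp add: sum.If_cases Int_def)
    finally show ?thesis using le by linarith
  qed

  \<comment> \<open>The matching is read as chains: fixed elements form \<open>S\<close>, the other
    edges between elements form the successor relation \<open>G\<close>, and an element matched from
    a dummy starts a chain.\<close>
  define S where "S = {x\<in>Q. f (Inl x) = Inl x}"
  define G where "G = {(x, y). x \<in> Q \<and> f (Inl x) = Inl y \<and> x \<noteq> y}"
  define St where "St = {y. \<exists>i\<in>Q. f (Inr i) = Inl y}"
  define D where "D = (\<lambda>y. G\<^sup>* `` {y}) ` St"
  have fQ: "f z \<in> Q <+> Q" if "z \<in> Q <+> Q" for z using bij_betwE[OF f] that by blast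
  have StQ: "St \<subseteq> Q" using fQ by (force simp: St_def)
  have Gs: "G \<subseteq> s - Id"
    using tight by (force simp: G_def E_def split: sum.splits)
  have Gstar: "(x, y) \<in> s" if "(x, y) \<in> G\<^sup>*" "x \<in> Q" for x y
    using that(1)
  proof (induction rule: rtrancl_induct)
    case base
    show ?case using refl that(2) .
  next
    case (step y z)
    then show ?case using Gs trans by (meson DiffD1 subsetD transD)
  qed
  have chains: "C \<in> Chains s" if "C \<in> D" for C
  proof -
    obtain y where y: "y \<in> St" "C = G\<^sup>* `` {y}" using \<open>C \<in> D\<close> by (auto simp: D_def)
    \<comment> \<open>With unique successors, of two points reachable from \<open>y\<close> one is
      reachable from the other.\<close>
    have sv: "single_valued G" by (auto simp: single_valued_def G_def)
    show ?thesis unfolding Chains_def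
    proof (clarify)
      fix p q assume pq: "p \<in> C" "q \<in> C" "(q, p) \<notin> s"
      then have "p \<in> Q" "q \<in> Q" using Gstar[of y] y StQ sub by auto
      then show "(p, q) \<in> s"
        using single_valued_confluent[OF sv, of y p q] pq y(2) Gstar by auto
    qed
  qed
  \<comment> \<open>The preimage of \<open>Inl x\<close> under \<open>f\<close> is a dummy,
    \<open>Inl x\<close> itself, or some \<open>Inl w\<close> with \<open>w\<close> strictly below
    \<open>x\<close>. In the last case \<open>w\<close> is outside \<open>S\<close> because
    \<open>f\<close> moves it, so by induction it lies on a chain of \<open>D\<close>, which
    continues to \<open>x\<close>.\<close>
  have cover: "x \<in> S \<union> \<Union>D" if "x \<in> Q" for x
  proof -
    have "finite s" using sub fin by (meson finite_SigmaI finite_subset)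
    then have "wf (s - Id)" using po by (rule partial_order_on_well_order_on)
    then show ?thesis using that
    proof (induction x rule: wf_induct_rule)
      case (less x)
      then obtain z where z: "z \<in> Q <+> Q" "f z = Inl x"
        using bij_betw_imp_surj_on[OF f] by (metis InlI imageE)
      show ?case
      proof (cases z)
        case (Inr i)
        then have "x \<in> St" using z by (auto simp: St_def)
        then show ?thesis by (auto simp: D_def)
      next
        case (Inl w)
        show ?thesis
        proof (cases "w = x")
          case True
          then show ?thesis using z Inl less.prems by (simp add: S_def)
        next
          case False
          then have wx: "(w, x) \<in> G" using z Inl by (auto simp: G_def)
          then have "w \<in> S \<union> \<Union>D" using less.IH Gs z Inl by auto
          moreover have "w \<notin> S" using False z Inl by (auto simp: S_def)
          ultimately show ?thesis using wx by (auto simp: D_def intro: rtrancl_into_rtrancl)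
        qed
      qed
    qed
  qed
  have "D \<subseteq> Pow Q"
    using chains sub by (force simp: Chains_def)
  then have DQ: "\<Union>D \<subseteq> Q" by blast
  have finSt: "finite St" using StQ fin by (rule finite_subset)
  have "int (card S + k * card D) \<le> cost"
  proof -
    have "card D \<le> card St" unfolding D_def using finSt by (rule card_image_le)
    also have "\<dots> \<le> card {i\<in>Q. \<exists>y. f (Inr i) = Inl y}"
    proof -
      have "St \<subseteq> (\<lambda>i. projl (f (Inr i))) ` {i\<in>Q. \<exists>y. f (Inr i) = Inl y}"
        by (force simp: St_def)
      then show ?thesis using fin by (intro surj_card_le) auto
    qed
    finally have le: "card D \<le> card {i\<in>Q. \<exists>y. f (Inr i) = Inl y}" .
    \<comment> \<open>Successor edges and edges into dummies are free; only fixed elements and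
      dummies that start chains pay.\<close>
    have "(\<Sum>x\<in>Q. c (Inl x) (f (Inl x))) = (\<Sum>x\<in>Q. if f (Inl x) = Inl x then 1 else 0)"
      by (intro sum.cong) (auto simp: c_def split: sum.splits)
    moreover have "(\<Sum>i\<in>Q. c (Inr i) (f (Inr i))) = (\<Sum>i\<in>Q. if \<exists>y. f (Inr i) = Inl y then int k else 0)"
      by (intro sum.cong) (auto simp: c_def split: sum.splits)
    ultimately have "cost = int (card S + k * card {i\<in>Q. \<exists>y. f (Inr i) = Inl y})"
      unfolding cost_def sum.Plus[OF fin fin] using fin
      by (simp add: sum.If_cases Int_def S_def)
    then show ?thesis using mult_le_mono2[OF le, of k] by (simp only: of_nat_le_iff add_le_cancel_left)
  qed
  then have size: "card S + k * card D \<le> max_antichain_union k Q s" using dual by linarith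
  have SQ: "S \<subseteq> Q" by (auto simp: S_def)
  have "Q = S \<union> \<Union>D" using cover DQ SQ by blast
  moreover have "finite D" using finSt by (simp add: D_def)
  ultimately show ?thesis using that[OF SQ _ chains _ size] by blast
qed

section \<open>Semiantichains and unichain coverings\<close>

text \<open>A unichain contains at most one point of \<open>S\<close>, so choosing for each point a
  member of \<open>\<F>\<close> through it is injective.\<close>

lemma semiantichain_card_le_covering:
  assumes S: "semiantichain A r B s S" and F: "unichain_covering A r B s \<F>" and fin: "finite \<F>"
  shows "card S \<le> card \<F>"
proof -
  have "\<forall>x\<in>S. \<exists>X\<in>\<F>. x \<in> X"
  proof
    fix x assume "x \<in> S"
    then have "x \<in> \<Union>\<F>" using S F unfolding semiantichain_def unichain_covering_def by blast
    then show "\<exists>X\<in>\<F>. x \<in> X" by blast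
  qed
  then obtain g where g: "\<And>x. x \<in> S \<Longrightarrow> g x \<in> \<F> \<and> x \<in> g x" by metis
  have "inj_on g S"
  proof (rule inj_onI, rule ccontr)
    fix x y assume xy: "x \<in> S" "y \<in> S" "g x = g y" "x \<noteq> y"
    then have "unichain A r B s (g x)" "x \<in> g x" "y \<in> g x"
      using g[of x] g[of y] F unfolding unichain_covering_def by simp_all
    then show False using S xy unfolding semiantichain_def by blast
  qed
  then show ?thesis using g fin by (intro card_inj_on_le[of g]) auto
qed

text \<open>Two points of a common unichain agree in one coordinate. If it is the first, they share
  a level, so their second coordinates lie in one antichain. If it is the second, disjointness of
  the antichains puts the first coordinates in one level, where \<open>U\<close>, hence
  \<open>r\<close>, relates no distinct elements.\<close>

lemma rectangular_semiantichain:
  assumes "rectangular P r w h" and finQ: "finite Q"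
  obtains S where "semiantichain P r Q s S" "card S = w * max_antichain_union h Q s"
proof -
  obtain U Lv where Lv: "weak_order_levels P U h Lv" "\<forall>i\<in>{1..h}. card (Lv i) = w"
    and rU: "r \<subseteq> U" and finP: "finite P"
    using assms(1) unfolding rectangular_def by blast
  have LvP: "Lv i \<subseteq> P" if "i \<in> {1..h}" for i
    using Lv(1) that by (auto simp: weak_order_levels_def)
  have level: "i = j" if "i \<in> {1..h}" "j \<in> {1..h}" "x \<in> Lv i" "x \<in> Lv j" for i j x
    using Lv(1) that unfolding weak_order_levels_def disjoint_family_on_def by blast
  have incomp: "x = y" if "i \<in> {1..h}" "x \<in> Lv i" "y \<in> Lv i" "(x, y) \<in> r" for i x y
    using Lv(1) that rU unfolding weak_order_levels_def by blast
  obtain F where F: "\<And>i. i < h \<Longrightarrow> antichain Q s (F i)" and disj: "disjoint_family F"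
    and card: "card (\<Union>i<h. F i) = max_antichain_union h Q s"
    using max_antichain_union_attained[OF finQ, where k = h and r = s] by blast
  have finF: "finite (F i)" if "i < h" for i
    using F[OF that] finQ finite_subset by (auto simp: antichain_def)
  \<comment> \<open>Levels are numbered from 1, antichains from 0.\<close>
  define S where "S = (\<Union>i<h. Lv (Suc i) \<times> F i)"
  have "semiantichain P r Q s S"
    unfolding semiantichain_def
  proof (intro conjI ballI impI notI)
    show "S \<subseteq> P \<times> Q" unfolding S_def
    proof (rule UN_least)
      fix i assume "i \<in> {..<h}"
      then show "Lv (Suc i) \<times> F i \<subseteq> P \<times> Q"
        using LvP[of "Suc i"] F[of i] by (intro Sigma_mono) (auto simp: antichain_def)
    qed
    fix x y assume x: "x \<in> S" and y: "y \<in> S" and neq: "x \<noteq> y"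
      and "\<exists>X. unichain P r Q s X \<and> x \<in> X \<and> y \<in> X"
    then obtain X where X: "unichain P r Q s X" "x \<in> X" "y \<in> X" by blast
    obtain i p q where i: "i < h" "p \<in> Lv (Suc i)" "q \<in> F i" "x = (p, q)"
      using x by (auto simp: S_def)
    obtain j p' q' where j: "j < h" "p' \<in> Lv (Suc j)" "q' \<in> F j" "y = (p', q')"
      using y by (auto simp: S_def)
    from X consider "p = p'" "(q, q') \<in> s \<or> (q', q) \<in> s" | "q = q'" "(p, p') \<in> r \<or> (p', p) \<in> r"
      by (auto simp: unichain_def Chains_def i j)
    then show False
    proof cases
      case 1
      then have "i = j" using level[of "Suc i" "Suc j" p] i j by auto
      then show False using 1 F[of i] i j neq by (auto simp: antichain_def)
    next
      case 2
      then have "i = j" using disj i j by (auto simp: disjoint_family_on_def)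
      then show False using 2 incomp[of "Suc i" p p'] incomp[of "Suc i" p' p] i j neq by auto
    qed
  qed
  moreover have "card S = w * max_antichain_union h Q s"
  proof -
    have "card S = (\<Sum>i<h. card (Lv (Suc i) \<times> F i))" unfolding S_def
    proof (rule card_UN_disjoint)
      show "\<forall>i\<in>{..<h}. finite (Lv (Suc i) \<times> F i)"
      proof
        fix i assume "i \<in> {..<h}"
        then show "finite (Lv (Suc i) \<times> F i)"
          using finF[of i] finite_subset[OF LvP[of "Suc i"] finP] by simp
      qed
      show "\<forall>i\<in>{..<h}. \<forall>j\<in>{..<h}. i \<noteq> j \<longrightarrow> (Lv (Suc i) \<times> F i) \<inter> (Lv (Suc j) \<times> F j) = {}"
      proof (intro ballI impI)
        fix i j assume "i \<in> {..<h}" "j \<in> {..<h}" "i \<noteq> j"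
        then have "F i \<inter> F j = {}" using disj by (simp add: disjoint_family_on_def)
        then show "(Lv (Suc i) \<times> F i) \<inter> (Lv (Suc j) \<times> F j) = {}" by blast
      qed
    qed simp
    also have "\<dots> = w * (\<Sum>i<h. card (F i))"
      using Lv(2) by (simp add: card_cartesian_product sum_distrib_left)
    also have "(\<Sum>i<h. card (F i)) = card (\<Union>i<h. F i)"
      using finF disj by (subst card_UN_disjoint) (auto simp: disjoint_family_on_def)
    finally show ?thesis using card by simp
  qed
  ultimately show ?thesis using that by blast
qed

text \<open>There are at most \<open>w * card S\<close> products of chains with points and
  \<open>w * h * card D\<close> products of points with chains, in total \<open>w\<close> times the
  weight bounded by \<open>greene_kleitman_cover\<close>.\<close>

lemma rectangular_unichain_covering:
  assumes rect: "rectangular P r w h" and finQ: "finite Q" and po: "partial_order_on Q s"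
  obtains \<F> where "unichain_covering P r Q s \<F>" "card \<F> \<le> w * max_antichain_union h Q s"
proof -
  obtain L C where C: "disjoint_union_of_chains P L w C" "\<forall>i\<in>{1..w}. card (C i) = h"
    and Lr: "L \<subseteq> r" and finP: "finite P" and poP: "partial_order_on P r"
    using rect unfolding rectangular_def by blast
  have UC: "(\<Union>i\<in>{1..w}. C i) = P" and disj: "disjoint_family_on C {1..w}"
    using C(1) by (auto simp: disjoint_union_of_chains_def)
  have Cch: "C i \<in> Chains r" if "i \<in> {1..w}" for i
  proof -
    have "C i \<in> Chains L" using C(1) that by (simp add: disjoint_union_of_chains_def)
    then show ?thesis using Lr unfolding Chains_def by blast
  qed
  have cardP: "card P = w * h"
  proof -
    have "card P = (\<Sum>i\<in>{1..w}. card (C i))" unfolding UC[symmetric]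
      using disj finP UC by (intro card_UN_disjoint) (auto simp: disjoint_family_on_def intro: finite_subset)
    then show ?thesis using C(2) by simp
  qed
  note reflP = refl_onD[OF partial_order_onD(1)[OF poP]]
    and reflQ = refl_onD[OF partial_order_onD(1)[OF po]]
  obtain S D where S: "S \<subseteq> Q" and finD: "finite D" and D: "\<And>X. X \<in> D \<Longrightarrow> X \<in> Chains s"
    and Q: "Q = S \<union> \<Union>D" and le: "card S + h * card D \<le> max_antichain_union h Q s"
    using greene_kleitman_cover[OF finQ po, where k = h] by blast
  have finS: "finite S" using S finQ by (rule finite_subset)
  define \<F>1 where "\<F>1 = (\<lambda>(i, q). C i \<times> {q}) ` ({1..w} \<times> S)"
  define \<F>2 where "\<F>2 = (\<lambda>(p, X). {p} \<times> X) ` (P \<times> D)"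
  have "unichain P r Q s X" if X: "X \<in> \<F>1" for X
  proof -
    obtain i q where iq: "i \<in> {1..w}" "q \<in> S" "X = C i \<times> {q}"
      using X unfolding \<F>1_def by blast
    then have "q \<in> Q" using S by auto
    moreover have "X \<in> Chains (prod_order r s)"
      using iq(3) Cch[OF iq(1)] reflQ[OF \<open>q \<in> Q\<close>] by (auto simp: Chains_def prod_order_def)
    ultimately show ?thesis using iq(3) Cch[OF iq(1)] unfolding unichain_def by blast
  qed
  moreover have "unichain P r Q s X" if X: "X \<in> \<F>2" for X
  proof -
    obtain p Y where pY: "p \<in> P" "Y \<in> D" "X = {p} \<times> Y"
      using X unfolding \<F>2_def by blast
    have "X \<in> Chains (prod_order r s)"
      using pY(3) D[OF pY(2)] reflP[OF pY(1)] by (auto simp: Chains_def prod_order_def)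
    then show ?thesis using pY D[OF pY(2)] unfolding unichain_def by blast
  qed
  moreover have "\<Union>(\<F>1 \<union> \<F>2) = P \<times> Q"
  proof -
    have "\<Union>\<F>1 = P \<times> S" using UC by (auto simp: \<F>1_def)
    moreover have "\<Union>\<F>2 = P \<times> \<Union>D" by (auto simp: \<F>2_def)
    ultimately show ?thesis by (subst Q) (simp only: Union_Un_distrib Times_Un_distrib1 Sigma_Un_distrib2)
  qed
  ultimately have "unichain_covering P r Q s (\<F>1 \<union> \<F>2)"
    by (auto simp: unichain_covering_def)
  moreover have "card (\<F>1 \<union> \<F>2) \<le> w * max_antichain_union h Q s"
  proof -
    have "card (\<F>1 \<union> \<F>2) \<le> card \<F>1 + card \<F>2" by (rule card_Un_le)
    also have "\<dots> \<le> card ({1..w} \<times> S) + card (P \<times> D)"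
      unfolding \<F>1_def \<F>2_def using finS finP finD by (intro add_mono card_image_le) auto
    also have "\<dots> = w * (card S + h * card D)"
      by (simp add: card_cartesian_product cardP algebra_simps)
    also have "\<dots> \<le> w * max_antichain_union h Q s" using le by simp
    finally show ?thesis .
  qed
  ultimately show ?thesis using that by blast
qed

theorem theorem10:
  fixes P :: "'a set" and leP :: "'a rel" and Q :: "'b set" and leQ :: "'b rel" and w h :: nat
  assumes "rectangular P leP w h"
    and "finite Q" and "partial_order_on Q leQ"
  shows "max_semiantichain_size P leP Q leQ = min_unichain_covering_size P leP Q leQ \<and>
         min_unichain_covering_size P leP Q leQ = w * max_antichain_union h Q leQ"
proof -
  have P: "finite P" "partial_order_on P leP" using assms(1) by (auto simp: rectangular_def)
  note fin_cover = unichain_covering_sizes(1)[OF P(1) assms(2) P(2) assms(3)]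
  obtain S where S: "semiantichain P leP Q leQ S" "card S = w * max_antichain_union h Q leQ"
    using rectangular_semiantichain[OF assms(1,2)] by blast
  obtain \<F> where F: "unichain_covering P leP Q leQ \<F>" "card \<F> \<le> w * max_antichain_union h Q leQ"
    using rectangular_unichain_covering[OF assms] by blast
  note weak = semiantichain_card_le_covering[OF _ _ fin_cover]
  \<comment> \<open>Weak duality against \<open>S\<close> turns the upper bound into an equality;
    the common value certifies both \<open>S\<close> and \<open>\<F>\<close> as optimal.\<close>
  have cardF: "card \<F> = w * max_antichain_union h Q leQ"
    using weak[OF S(1) F(1) F(1)] S(2) F(2) by simp
  have "max_semiantichain_size P leP Q leQ = w * max_antichain_union h Q leQ"
    unfolding max_semiantichain_size_def
  proof (rule Max_eqI[OF semiantichain_sizes(1)[OF P(1) assms(2)]])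
    show "n \<le> w * max_antichain_union h Q leQ" if "n \<in> {card S |S. semiantichain P leP Q leQ S}" for n
      using that weak[OF _ F(1) F(1)] cardF by auto
    show "w * max_antichain_union h Q leQ \<in> {card S |S. semiantichain P leP Q leQ S}"
      using S by force
  qed
  moreover have "min_unichain_covering_size P leP Q leQ = w * max_antichain_union h Q leQ"
    unfolding min_unichain_covering_size_def
  proof (rule Min_eqI[OF unichain_covering_sizes(2)[OF P(1) assms(2) P(2) assms(3)]])
    show "w * max_antichain_union h Q leQ \<le> n"
      if "n \<in> {card \<F> |\<F>. unichain_covering P leP Q leQ \<F>}" for n
      using that weak[OF S(1)] S(2) by auto
    show "w * max_antichain_union h Q leQ \<in> {card \<F> |\<F>. unichain_covering P leP Q leQ \<F>}"
      using F(1) cardF by force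
  qed
  ultimately show ?thesis by simp
qed

end
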